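(* Let $M$ be a Puiseux monoid. Then the following statements hold. (1) If $M$ is a BFM, then $\mathcal{P}_{\mathrm{fin}}(M)$ is also a BFM. (2) If $M$ is an FFM, then $\mathcal{P}_{\mathrm{fin}}(M)$ is also an FFM.
   Context: All monoids are commutative semigroups with identity, written additively with identity $0$. A Puiseux monoid is a submonoid of $(\mathbb{Q}_{\ge 0},+)$. For a monoid $M$, the (finitary) power monoid $\mathcal{P}_{\mathrm{fin}}(M)$ is the set of all nonempty finite subsets of $M$ with operation $S+T := \{s+t \mid s\in S,\ t\in T\}$; its identity is $\{0\}$. Both a Puiseux monoid and its power monoid are reduced, i.e., their only invertible element is the identity. For a reduced monoid $N$, an element $a\in N\setminus\{0\}$ is an atom if whenever $a=r+s$ with $r,s\in N$, either $r=0$ or $s=0$. The monoid $N$ is atomic if every nonzero element of $N$ is a finite sum of atoms. A factorization of $x\in N$ is a finite multiset of atoms of $N$ (equivalently, an element of the free commutative monoid on the set of atoms of $N$) whose sum in $N$ is $x$; its length is the number of atoms in it, counting repetitions. The monoid $N$ is a bounded factorization monoid (BFM) if $N$ is atomic and for each $x\in N$ the set of lengths of factorizations of $x$ is finite. The monoid $N$ is a finite factorization monoid (FFM) if $N$ is atomic and each $x\in N$ has only finitely many factorizations. *)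

theory Defs
  imports Complex_Main "HOL-Library.Multiset" "HOL-Library.Set_Algebras"
begin

text \<open>Monoids are carrier sets inside a type of class \<^class>\<open>comm_monoid_add\<close>, with the operation and
  the identity of that type. \<^theory>\<open>HOL-Library.Set_Algebras\<close> makes the type of sets over such a
  type into another such type, where \<open>S + T = {s + t | s \<in> S, t \<in> T}\<close> and \<open>0 = {0}\<close>.\<close>

definition add_submonoid :: "'a::comm_monoid_add set \<Rightarrow> bool" where
  "add_submonoid N \<longleftrightarrow> 0 \<in> N \<and> (\<forall>x\<in>N. \<forall>y\<in>N. x + y \<in> N)"

definition reduced_monoid :: "'a::comm_monoid_add set \<Rightarrow> bool" where
  "reduced_monoid N \<longleftrightarrow> (\<forall>x\<in>N. \<forall>y\<in>N. x + y = 0 \<longrightarrow> x = 0)"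

definition puiseux_monoid :: "rat set \<Rightarrow> bool" where
  "puiseux_monoid M \<longleftrightarrow> add_submonoid M \<and> M \<subseteq> {0..}"

definition fin_power_monoid :: "'a::comm_monoid_add set \<Rightarrow> 'a set set" where
  "fin_power_monoid M = {S. S \<subseteq> M \<and> finite S \<and> S \<noteq> {}}"

text \<open>The notions below are the usual ones for reduced monoids, where \<open>0\<close> is the only unit.\<close>

definition atoms :: "'a::comm_monoid_add set \<Rightarrow> 'a set" where
  "atoms N = {a \<in> N. a \<noteq> 0 \<and> (\<forall>r\<in>N. \<forall>s\<in>N. a = r + s \<longrightarrow> r = 0 \<or> s = 0)}"

definition factorizations :: "'a::comm_monoid_add set \<Rightarrow> 'a \<Rightarrow> 'a multiset set" where
  "factorizations N x = {F. set_mset F \<subseteq> atoms N \<and> sum_mset F = x}"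

definition factorization_lengths :: "'a::comm_monoid_add set \<Rightarrow> 'a \<Rightarrow> nat set" where
  "factorization_lengths N x = size ` factorizations N x"

definition atomic_monoid :: "'a::comm_monoid_add set \<Rightarrow> bool" where
  "atomic_monoid N \<longleftrightarrow> (\<forall>x\<in>N. x \<noteq> 0 \<longrightarrow> factorizations N x \<noteq> {})"

definition BFM :: "'a::comm_monoid_add set \<Rightarrow> bool" where
  "BFM N \<longleftrightarrow> atomic_monoid N \<and> (\<forall>x\<in>N. finite (factorization_lengths N x))"

definition FFM :: "'a::comm_monoid_add set \<Rightarrow> bool" where
  "FFM N \<longleftrightarrow> atomic_monoid N \<and> (\<forall>x\<in>N. finite (factorizations N x))"

lemma add_submonoid_fin_power_monoid:
  assumes "add_submonoid M"
  shows "add_submonoid (fin_power_monoid M)"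
  using assms unfolding add_submonoid_def fin_power_monoid_def
  by (auto simp: set_plus_def set_zero finite_set_plus[unfolded set_plus_def])

lemma reduced_puiseux_monoid:
  assumes "puiseux_monoid M"
  shows "reduced_monoid M"
  using assms unfolding puiseux_monoid_def reduced_monoid_def
  by (metis add_nonneg_eq_0_iff atLeast_iff subsetD)

lemma reduced_fin_power_monoid:
  assumes "puiseux_monoid M"
  shows "reduced_monoid (fin_power_monoid M)"
  unfolding reduced_monoid_def
proof (intro ballI impI)
  fix S T assume S: "S \<in> fin_power_monoid M" and T: "T \<in> fin_power_monoid M" and "S + T = 0"
  then have sum: "s + t = 0" if "s \<in> S" "t \<in> T" for s t
    using that set_plus_intro[of s S t T] by (simp add: set_zero)
  have "s = 0" if "s \<in> S" for s
  proof -
    obtain t where "t \<in> T" using T by (auto simp: fin_power_monoid_def)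
    then show ?thesis using that S T sum reduced_puiseux_monoid[OF assms]
      unfolding reduced_monoid_def fin_power_monoid_def by blast
  qed
  then show "S = 0" using S by (auto simp: fin_power_monoid_def set_zero)
qed

end

theory Submission
  imports Defs
begin

text \<open>Both properties can be tested without looking at factorizations. A monoid is a BFM as soon as
  it carries a \<^emph>\<open>length function\<close>: a superadditive map to the natural numbers that is positive
  off the identity (lemma \<open>BFM_if_length_function\<close>). Conversely, on a BFM the maximal length of a
  factorization is such a map (lemma \<open>length_function_Max_lengths\<close>). A monoid with a length
  function is moreover an FFM if each element has only finitely many divisors
  (lemma \<open>FFM_if_finite_divisors\<close>), and in an FFM each element has finitely many divisors
  because each divisor is the sum of a submultiset of one of the factorizations
  (lemma \<open>finite_divisors_if_FFM\<close>).

  Both criteria pass from a Puiseux monoid \<open>M\<close> to its power monoid. The order of the rationals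
  gives \<open>Max (S + T) = Max S + Max T\<close>, and \<open>Max S \<noteq> 0\<close> for \<open>S \<noteq> {0}\<close>, so a length function
  \<open>l\<close> on \<open>M\<close> induces the length function \<open>S \<mapsto> l (Max S)\<close>. If \<open>S = A + B\<close>, then fixing any
  \<open>b \<in> B\<close> shows that each element of \<open>A\<close> divides an element of \<open>S\<close>; hence \<open>A\<close> is a subset of a
  finite set that depends on \<open>S\<close> only, and \<open>S\<close> has finitely many divisors.\<close>

section \<open>Factorizations and divisors\<close>

definition divisors :: "'a::comm_monoid_add set \<Rightarrow> 'a \<Rightarrow> 'a set" where
  "divisors N x = {d \<in> N. \<exists>e\<in>N. x = d + e}"

lemma sum_mset_in_submonoid:
  assumes "add_submonoid N" "set_mset F \<subseteq> N"
  shows "sum_mset F \<in> N"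
  using assms(2) by (induction F) (use assms(1) in \<open>auto simp: add_submonoid_def\<close>)

lemma atoms_subset: "atoms N \<subseteq> N"
  by (auto simp: atoms_def)

lemma factorizations_add:
  assumes "F \<in> factorizations N x" "G \<in> factorizations N y"
  shows "F + G \<in> factorizations N (x + y)"
  using assms by (auto simp: factorizations_def)

lemma factorization_exists:
  assumes "atomic_monoid N" "x \<in> N"
  shows "\<exists>F. F \<in> factorizations N x"
proof (cases "x = 0")
  case True
  then have "{#} \<in> factorizations N x" by (simp add: factorizations_def)
  then show ?thesis ..
next
  case False
  then show ?thesis using assms by (auto simp: atomic_monoid_def)
qed

lemma factorization_atom_divides:
  assumes "add_submonoid N" "F \<in> factorizations N x" "a \<in># F"
  shows "a \<in> divisors N x"
proof -
  obtain G where G: "F = add_mset a G" using assms(3) by (metis mset_add)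
  have "a \<in> N" "set_mset G \<subseteq> N" "x = a + sum_mset G"
    using assms(2) G atoms_subset by (auto simp: factorizations_def)
  then show ?thesis using sum_mset_in_submonoid[OF assms(1)] by (auto simp: divisors_def)
qed

section \<open>Length functions and bounded factorizations\<close>

definition length_function :: "'a::comm_monoid_add set \<Rightarrow> ('a \<Rightarrow> nat) \<Rightarrow> bool" where
  "length_function N l \<longleftrightarrow>
    (\<forall>x\<in>N. \<forall>y\<in>N. l x + l y \<le> l (x + y)) \<and> (\<forall>x\<in>N. x \<noteq> 0 \<longrightarrow> 0 < l x)"

text \<open>Each atom contributes at least 1 to the value of a length function, by superadditivity.\<close>

lemma size_factorization_le:
  assumes "add_submonoid N" "length_function N l" "F \<in> factorizations N x"
  shows "size F \<le> l x"
proof -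
  have "set_mset F \<subseteq> atoms N \<Longrightarrow> size F \<le> l (sum_mset F)" for F
  proof (induction F)
    case empty
    show ?case by simp
  next
    case (add a F)
    then have a: "a \<in> N" "a \<noteq> 0" and F: "set_mset F \<subseteq> N"
      using atoms_subset by (auto simp: atoms_def)
    have "1 + size F \<le> l a + l (sum_mset F)"
      using add assms(2) a by (intro add_mono) (auto simp: length_function_def Suc_le_eq)
    also have "\<dots> \<le> l (a + sum_mset F)"
      using assms(2) a sum_mset_in_submonoid[OF assms(1) F] by (auto simp: length_function_def)
    finally show ?case by simp
  qed
  then show ?thesis using assms(3) by (auto simp: factorizations_def)
qed

text \<open>A proper decomposition \<open>x = r + s\<close> strictly decreases the length function on both summands,
  so the process of splitting nonatoms stops.\<close>

lemma atomic_if_length_function: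
  assumes "length_function N l"
  shows "atomic_monoid N"
proof -
  have "x \<in> N \<Longrightarrow> x \<noteq> 0 \<Longrightarrow> \<exists>F. F \<in> factorizations N x" for x
  proof (induction "l x" arbitrary: x rule: less_induct)
    case less
    show ?case
    proof (cases "x \<in> atoms N")
      case True
      then have "{#x#} \<in> factorizations N x" by (simp add: factorizations_def)
      then show ?thesis ..
    next
      case False
      then obtain r s where rs: "r \<in> N" "s \<in> N" "x = r + s" "r \<noteq> 0" "s \<noteq> 0"
        using less.prems by (auto simp: atoms_def)
      then have "l r + l s \<le> l x" "0 < l r" "0 < l s"
        using assms by (auto simp: length_function_def)
      then obtain F G where "F \<in> factorizations N r" "G \<in> factorizations N s"
        using less.hyps[of r] less.hyps[of s] rs by auto
      then show ?thesis using factorizations_add rs(3) by blast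
    qed
  qed
  then show ?thesis by (auto simp: atomic_monoid_def)
qed

lemma BFM_if_length_function:
  assumes "add_submonoid N" "length_function N l"
  shows "BFM N"
proof -
  have "factorization_lengths N x \<subseteq> {..l x}" for x
    using size_factorization_le[OF assms] by (auto simp: factorization_lengths_def)
  then show ?thesis
    using atomic_if_length_function[OF assms(2)] by (auto simp: BFM_def intro: finite_subset)
qed

text \<open>Superadditivity holds because longest factorizations of \<open>x\<close> and \<open>y\<close> combine to a
  factorization of \<open>x + y\<close>; positivity holds because the empty multiset factors only \<open>0\<close>.\<close>

lemma length_function_Max_lengths:
  assumes "add_submonoid N" "BFM N"
  shows "length_function N (\<lambda>x. Max (factorization_lengths N x))"
proof -
  let ?L = "factorization_lengths N"
  have fin: "finite (?L x)" if "x \<in> N" for x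
    using assms(2) that by (simp add: BFM_def)
  have ex: "\<exists>F. F \<in> factorizations N x" if "x \<in> N" for x
    using assms(2) that factorization_exists by (auto simp: BFM_def)
  have attained: "\<exists>F \<in> factorizations N x. size F = Max (?L x)" if "x \<in> N" for x
  proof -
    have "Max (?L x) \<in> ?L x"
      using fin[OF that] ex[OF that] by (intro Max_in) (auto simp: factorization_lengths_def)
    then show ?thesis by (auto simp: factorization_lengths_def)
  qed
  have bound: "size F \<le> Max (?L x)" if "x \<in> N" "F \<in> factorizations N x" for F x
    using fin that by (intro Max_ge) (auto simp: factorization_lengths_def)
  have "Max (?L x) + Max (?L y) \<le> Max (?L (x + y))" if xy: "x \<in> N" "y \<in> N" for x y
  proof -
    obtain F G where "F \<in> factorizations N x" "size F = Max (?L x)"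
      "G \<in> factorizations N y" "size G = Max (?L y)"
      using attained xy by blast
    moreover have "x + y \<in> N" using assms(1) xy by (simp add: add_submonoid_def)
    ultimately show ?thesis using bound[of "x + y" "F + G"] factorizations_add by fastforce
  qed
  moreover have "0 < Max (?L x)" if x: "x \<in> N" "x \<noteq> 0" for x
  proof -
    obtain F where F: "F \<in> factorizations N x" using ex x by blast
    then have "F \<noteq> {#}" using x by (auto simp: factorizations_def)
    then show ?thesis using bound[OF x(1) F] by (simp add: nonempty_has_size)
  qed
  ultimately show ?thesis by (simp add: length_function_def)
qed

section \<open>Finitely many divisors and finite factorizations\<close>

lemma finite_msets_bounded_size:
  assumes "finite A"
  shows "finite {F. set_mset F \<subseteq> A \<and> size F \<le> n}"
proof (rule finite_subset)
  show "{F. set_mset F \<subseteq> A \<and> size F \<le> n} \<subseteq> mset ` {xs. set xs \<subseteq> A \<and> length xs \<le> n}"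
  proof
    fix F assume F: "F \<in> {F. set_mset F \<subseteq> A \<and> size F \<le> n}"
    obtain xs where "F = mset xs" by (metis ex_mset)
    then show "F \<in> mset ` {xs. set xs \<subseteq> A \<and> length xs \<le> n}" using F by auto
  qed
  show "finite (mset ` {xs. set xs \<subseteq> A \<and> length xs \<le> n})"
    using finite_lists_length_le[OF assms] by simp
qed

text \<open>The factorizations of \<open>x\<close> are multisets over the finite set of divisors of \<open>x\<close>, and the
  length function bounds their size.\<close>

lemma FFM_if_finite_divisors:
  assumes "add_submonoid N" "length_function N l" "\<And>x. x \<in> N \<Longrightarrow> finite (divisors N x)"
  shows "FFM N"
proof -
  have "finite (factorizations N x)" if "x \<in> N" for x
  proof (rule finite_subset)
    show "factorizations N x \<subseteq> {F. set_mset F \<subseteq> divisors N x \<and> size F \<le> l x}"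
      using factorization_atom_divides[OF assms(1)] size_factorization_le[OF assms(1,2)] by auto
  qed (rule finite_msets_bounded_size[OF assms(3)[OF that]])
  then show ?thesis using atomic_if_length_function[OF assms(2)] by (simp add: FFM_def)
qed

text \<open>If \<open>x = d + e\<close>, then a factorization of \<open>d\<close> extends by one of \<open>e\<close> to a factorization of
  \<open>x\<close>. So the submultisets of the finitely many factorizations of \<open>x\<close> account for all divisors.\<close>

lemma finite_divisors_if_FFM:
  assumes "FFM N" "x \<in> N"
  shows "finite (divisors N x)"
proof (rule finite_subset)
  show "divisors N x \<subseteq> sum_mset ` (\<Union>F\<in>factorizations N x. {G. G \<subseteq># F})"
  proof
    fix d assume "d \<in> divisors N x"
    then obtain e where de: "d \<in> N" "e \<in> N" "x = d + e" by (auto simp: divisors_def)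
    then obtain G H where G: "G \<in> factorizations N d" and H: "H \<in> factorizations N e"
      using assms(1) factorization_exists by (meson FFM_def)
    have "G + H \<in> factorizations N x" using factorizations_add[OF G H] de by simp
    moreover have "G \<subseteq># G + H" by simp
    moreover have "d = sum_mset G" using G by (simp add: factorizations_def)
    ultimately show "d \<in> sum_mset ` (\<Union>F\<in>factorizations N x. {G. G \<subseteq># F})" by blast
  qed
  have "finite {G. G \<subseteq># F}" for F :: "'a multiset"
    by (rule finite_subset[OF _ finite_msets_bounded_size[of "set_mset F" "size F"]])
      (auto dest: mset_subset_eqD size_mset_mono)
  then show "finite (sum_mset ` (\<Union>F\<in>factorizations N x. {G. G \<subseteq># F}))"
    using assms by (simp add: FFM_def)
qed

lemma FFM_imp_BFM: "FFM N \<Longrightarrow> BFM N"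
  by (simp add: FFM_def BFM_def factorization_lengths_def)

section \<open>Power monoids\<close>

lemma Max_set_plus:
  fixes S T :: "'a::linordered_ab_group_add set"
  assumes "finite S" "S \<noteq> {}" "finite T" "T \<noteq> {}"
  shows "Max (S + T) = Max S + Max T"
proof (rule Max_eqI)
  show "finite (S + T)" using assms by (simp add: finite_set_plus)
  show "Max S + Max T \<in> S + T" using assms by (intro set_plus_intro Max_in)
  show "y \<le> Max S + Max T" if "y \<in> S + T" for y
    using that assms by (auto elim!: set_plus_elim intro!: add_mono)
qed

text \<open>Here it matters that \<open>M\<close> is a monoid of nonnegative rationals: the total order makes
  \<open>Max\<close> additive, and nonnegativity makes \<open>{0}\<close> the only set with maximum \<open>0\<close>.\<close>

lemma length_function_fin_power_monoid:
  assumes "puiseux_monoid M" "length_function M l"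
  shows "length_function (fin_power_monoid M) (\<lambda>S. l (Max S))"
proof -
  have Max_M: "Max S \<in> M" if "S \<in> fin_power_monoid M" for S
    using that Max_in by (auto simp: fin_power_monoid_def)
  have "l (Max S) + l (Max T) \<le> l (Max (S + T))"
    if "S \<in> fin_power_monoid M" "T \<in> fin_power_monoid M" for S T
  proof -
    have "Max (S + T) = Max S + Max T"
      using that by (intro Max_set_plus) (auto simp: fin_power_monoid_def)
    then show ?thesis using Max_M that assms(2) by (simp add: length_function_def)
  qed
  moreover have "0 < l (Max S)" if S: "S \<in> fin_power_monoid M" "S \<noteq> 0" for S
  proof -
    have fin: "finite S" "S \<noteq> {}" "S \<subseteq> {0..}"
      using S(1) assms(1) by (auto simp: fin_power_monoid_def puiseux_monoid_def)
    have "S \<noteq> {0}" using S(2) by (simp add: set_zero)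
    then obtain s where s: "s \<in> S" "s \<noteq> 0" using fin(2) by blast
    then have "0 < s" using fin(3) by force
    also have "s \<le> Max S" using s fin by simp
    finally show ?thesis using Max_M[OF S(1)] assms(2) by (simp add: length_function_def)
  qed
  ultimately show ?thesis by (simp add: length_function_def)
qed

text \<open>A divisor \<open>A\<close> of \<open>S\<close> has a translate \<open>A + {b} \<subseteq> S\<close> with \<open>b \<in> M\<close>, so every
  \<open>a \<in> A\<close> divides the element \<open>a + b\<close> of \<open>S\<close>.\<close>

lemma divisors_fin_power_monoid_subset:
  "divisors (fin_power_monoid M) S \<subseteq> Pow (\<Union>s\<in>S. divisors M s)"
proof
  fix A assume "A \<in> divisors (fin_power_monoid M) S"
  then obtain B where A: "A \<subseteq> M" and B: "B \<subseteq> M" "B \<noteq> {}" and S: "S = A + B"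
    by (auto simp: divisors_def fin_power_monoid_def)
  obtain b where b: "b \<in> B" using B(2) by blast
  have "a \<in> divisors M (a + b) \<and> a + b \<in> S" if "a \<in> A" for a
    using that A B b S by (auto simp: divisors_def)
  then show "A \<in> Pow (\<Union>s\<in>S. divisors M s)" by blast
qed

lemma finite_divisors_fin_power_monoid:
  assumes "\<And>x. x \<in> M \<Longrightarrow> finite (divisors M x)" "S \<in> fin_power_monoid M"
  shows "finite (divisors (fin_power_monoid M) S)"
proof (rule finite_subset[OF divisors_fin_power_monoid_subset])
  show "finite (Pow (\<Union>s\<in>S. divisors M s))"
    using assms by (auto simp: fin_power_monoid_def)
qed

theorem theorem4p3:
  fixes M :: "rat set"
  assumes "puiseux_monoid M"
  shows "(BFM M \<longrightarrow> BFM (fin_power_monoid M)) \<and> (FFM M \<longrightarrow> FFM (fin_power_monoid M))"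
proof -
  have M: "add_submonoid M" using assms by (simp add: puiseux_monoid_def)
  note P = add_submonoid_fin_power_monoid[OF M]
  have len: "\<exists>l. length_function (fin_power_monoid M) l" if "BFM M"
    using length_function_fin_power_monoid[OF assms length_function_Max_lengths[OF M that]] by blast
  have "BFM (fin_power_monoid M)" if "BFM M"
    using len[OF that] BFM_if_length_function[OF P] by blast
  moreover have "FFM (fin_power_monoid M)" if FFM: "FFM M"
  proof -
    obtain l where "length_function (fin_power_monoid M) l"
      using len[OF FFM_imp_BFM[OF FFM]] ..
    then show ?thesis
      using FFM_if_finite_divisors[OF P] finite_divisors_fin_power_monoid
        finite_divisors_if_FFM[OF FFM] by blast
  qed
  ultimately show ?thesis by blast
qed

end
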